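(* Let $0<q<1$ and let $\Gamma_q$ denote Jackson's $q$-gamma function \[ \Gamma_q(x)=\frac{(q;q)_\infty}{(q^x;q)_\infty}(1-q)^{1-x}\qquad (x>0). \] Then for every real $t\ge 0$, \[ \int_0^1 \log\Gamma_q(x+t)\,dx=\Big(\tfrac12-t\Big)\log(1-q)-\frac{1}{\log q}\,\mathrm{Li}_2(q^t)+\log (q;q)_\infty . \] In particular, for $t=0$, \[ \int_0^1 \log\Gamma_q(x)\,dx=\tfrac12\log(1-q)-\frac{\zeta(2)}{\log q}+\log(q;q)_\infty . \]
   Context: For $|q|<1$ and complex $a$, $(a;q)_\infty=\prod_{i=0}^{\infty}(1-aq^i)$. The dilogarithm is $\mathrm{Li}_2(z)=\sum_{n=1}^\infty z^n/n^2$ for $|z|\le 1$, so that $\mathrm{Li}_2(1)=\zeta(2)$. Here $\log$ denotes the natural logarithm. *)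

theory Defs
  imports "HOL-Analysis.Analysis"
begin

definition qpochhammer_inf :: "'a::real_normed_field \<Rightarrow> 'a \<Rightarrow> 'a" where
  "qpochhammer_inf a q = (\<Prod>i. 1 - a * q ^ i)"

definition dilog :: "'a::{real_normed_field,banach} \<Rightarrow> 'a" where
  "dilog z = (\<Sum>n. z ^ Suc n / of_nat (Suc n) ^ 2)"

text \<open>The Riemann zeta function as a Dirichlet series; only meaningful for \<open>s > 1\<close>.\<close>

definition zeta_real :: "real \<Rightarrow> real" where
  "zeta_real s = (\<Sum>n. 1 / real (Suc n) powr s)"

text \<open>Jackson's \<open>q\<close>-gamma function, for \<open>0 < q < 1\<close> and \<open>x > 0\<close>.\<close>

definition q_Gamma :: "real \<Rightarrow> real \<Rightarrow> real" where
  "q_Gamma q x =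
     qpochhammer_inf q q / qpochhammer_inf (q powr x) q * (1 - q) powr (1 - x)"

end

theory Submission
  imports Defs
begin

text \<open>
  The function \<open>y \<mapsto> Li\<^sub>2(q\<^sup>y) / log q\<close> is an antiderivative of \<open>y \<mapsto> - log (1 - q\<^sup>y)\<close>. Hence
  integrating \<open>- log (q\<^bsup>x+t\<^esup>; q)\<^sub>\<infinity> = (\<Sum>i. - log (1 - q\<^bsup>x+t+i\<^esup>))\<close> termwise over \<open>[0, 1]\<close>, which is
  justified by monotone convergence, gives a telescoping series with sum \<open>- Li\<^sub>2(q\<^sup>t) / log q\<close>.
\<close>

lemma summable_inverse_Suc_squares: "summable (\<lambda>n. 1 / real (Suc n) ^ 2)"
  using inverse_squares_sums by (auto simp: sums_iff add.commute)

text \<open>The Weierstrass M-test with majorant \<open>1 / (n + 1)^2\<close> reaches the endpoint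
  1. Continuity there covers \<open>t = 0\<close>, where \<open>q powr t = 1\<close>; continuity at
  0 gives the limit of the telescoping sums.\<close>

lemma continuous_on_dilog: "continuous_on {0..1} (dilog :: real \<Rightarrow> real)"
proof -
  have "uniform_limit {0..1} (\<lambda>n z::real. \<Sum>i<n. z ^ Suc i / of_nat (Suc i) ^ 2) dilog sequentially"
    unfolding dilog_def
  proof (rule Weierstrass_m_test)
    fix n and z :: real
    assume "z \<in> {0..1}"
    then have "z ^ Suc n \<le> 1" "z ^ Suc n \<ge> 0"
      by (auto simp del: power_Suc intro: power_le_one)
    then show "norm (z ^ Suc n / of_nat (Suc n) ^ 2) \<le> 1 / real (Suc n) ^ 2"
      by (simp del: power_Suc of_nat_Suc add: divide_right_mono)
  qed (rule summable_inverse_Suc_squares)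
  then show ?thesis
    by (rule uniform_limit_theorem[rotated])
       (auto intro!: always_eventually continuous_on_sum continuous_on_divide continuous_on_mult
          continuous_on_power continuous_on_id continuous_on_const simp del: of_nat_Suc)
qed

text \<open>Inside the disc of convergence the series may be differentiated termwise, and the
  resulting series is the logarithm series divided by \<open>z\<close>.\<close>

lemma dilog_has_real_derivative:
  fixes z :: real
  assumes "0 < z" "z < 1"
  shows "(dilog has_real_derivative - ln (1 - z) / z) (at z)"
proof -
  \<comment> \<open>These are the coefficients of \<open>dilog\<close> as a power series indexed
    from 0; \<open>c 0 = 0\<close> because division by 0 yields 0.\<close>
  define c where "c = (\<lambda>n. 1 / real n ^ 2)"
  have summ: "summable (\<lambda>n. c n * w ^ n)" if "norm w \<le> 1" for w :: real
  proof (rule summable_comparison_test')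
    show "summable c"
      using summable_inverse_Suc_squares by (subst summable_Suc_iff[symmetric]) (simp add: c_def)
    show "norm (c n * w ^ n) \<le> c n" for n
      using that power_le_one[of "\<bar>w\<bar>" n]
      by (auto simp: c_def abs_mult power_abs intro!: divide_right_mono)
  qed
  have deriv: "((\<lambda>w. \<Sum>n. c n * w ^ n) has_real_derivative (\<Sum>n. diffs c n * z ^ n)) (at z)"
    by (rule termdiffs_strong[where K = 1]) (use summ[of 1] assms in auto)
  have "(\<lambda>n. - (z ^ n) / real n) sums ln (1 - z)"
    using ln_series'[of "- z"] assms by simp
  \<comment> \<open>The term at index 0 is \<open>- 1 / 0 = 0\<close>, so the shift preserves the
    sum.\<close>
  then have "(\<lambda>n. - (z ^ Suc n) / real (Suc n)) sums ln (1 - z)"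
    by (subst sums_Suc_iff) simp
  then have "(\<lambda>n. (- 1 / z) * (- (z ^ Suc n) / real (Suc n))) sums ((- 1 / z) * ln (1 - z))"
    by (rule sums_mult)
  moreover have "(- 1 / z) * (- (z ^ Suc n) / real (Suc n)) = diffs c n * z ^ n" for n
    using assms by (simp add: diffs_def c_def power2_eq_square del: of_nat_Suc)
  ultimately have "(\<Sum>n. diffs c n * z ^ n) = - ln (1 - z) / z"
    by (simp add: sums_iff)
  \<comment> \<open>A derivative depends only on values near \<open>z\<close>, so it suffices that
    the power series and \<open>dilog\<close> agree on a neighbourhood.\<close>
  moreover have "eventually (\<lambda>w. (\<Sum>n. c n * w ^ n) = dilog w) (nhds z)"
  proof -
    have "eventually (\<lambda>w. w \<in> {-1<..<1}) (nhds z)"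
      using assms by (intro eventually_nhds_in_open) auto
    then show ?thesis
    proof eventually_elim
      case (elim w)
      have "(\<Sum>n. c n * w ^ n) = (\<Sum>n. c (Suc n) * w ^ Suc n)"
        by (subst suminf_split_head) (use summ[of w] elim in \<open>auto simp: c_def\<close>)
      then show ?case
        by (simp add: dilog_def c_def)
    qed
  qed
  ultimately show ?thesis
    using deriv by (subst DERIV_cong_ev[symmetric]) auto
qed

text \<open>By the chain rule, the factors \<open>q powr y\<close> and \<open>ln q\<close> cancel.
  The interior form of the fundamental theorem admits \<open>a = 0\<close>: there
  \<open>q powr a = 1\<close>, where only continuity of \<open>dilog\<close> has been shown.\<close>

lemma has_integral_ln_one_minus_powr:
  fixes q a b :: real
  assumes q: "0 < q" "q < 1" and ab: "0 \<le> a" "a \<le> b"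
  shows "((\<lambda>y. - ln (1 - q powr y)) has_integral
           (dilog (q powr b) - dilog (q powr a)) / ln q) {a..b}"
proof -
  have "((\<lambda>y. - ln (1 - q powr y)) has_integral
           (dilog (q powr b) / ln q - dilog (q powr a) / ln q)) {a..b}"
  proof (rule fundamental_theorem_of_calculus_interior)
    show "continuous_on {a..b} (\<lambda>y. dilog (q powr y) / ln q)"
      using q ab
      by (intro continuous_intros continuous_on_compose2[OF continuous_on_dilog])
         (auto simp: powr_le1)
    fix y assume "y \<in> {a<..<b}"
    then have z: "0 < q powr y" "q powr y < 1"
      using q ab by (auto simp: powr01_less_one)
    have "((\<lambda>y. dilog (q powr y) / ln q) has_real_derivative
             (- ln (1 - q powr y) / q powr y) * (q powr y * ln q) / ln q) (at y)"
      using q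
      by (intro DERIV_cdivide DERIV_chain2[where f = dilog] dilog_has_real_derivative z)
         (auto intro!: derivative_eq_intros)
    then show "((\<lambda>y. dilog (q powr y) / ln q) has_vector_derivative - ln (1 - q powr y)) (at y)"
      using q z by (simp add: has_real_derivative_iff_has_vector_derivative)
  qed (use ab in auto)
  then show ?thesis
    by (simp add: diff_divide_distrib)
qed

text \<open>With \<open>z = q powr (y + i)\<close>, the bound
  \<open>- ln (1 - z) \<le> z / (1 - z)\<close> gives comparison with a geometric series.\<close>

lemma summable_ln_one_minus_powr:
  fixes q y :: real
  assumes q: "0 < q" "q < 1" and y: "0 \<le> y"
  shows "summable (\<lambda>i. - ln (1 - q powr (y + real i)))"
proof (rule summable_comparison_test')
  show "summable (\<lambda>i. q powr y / (1 - q) * q ^ i)"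
    using q by (intro summable_mult summable_geometric) auto
  fix i :: nat
  \<comment> \<open>Starting at index 1 keeps \<open>z \<le> q\<close>, hence \<open>1 - z\<close>
    away from 0; at \<open>i = 0\<close> and \<open>y = 0\<close> one would have
    \<open>z = 1\<close>.\<close>
  assume "1 \<le> i"
  define z where "z = q powr (y + real i)"
  have "z \<le> q powr 1"
    unfolding z_def using q y \<open>1 \<le> i\<close> by (intro powr_mono') auto
  then have z: "0 < z" "z \<le> q"
    using q by (auto simp: z_def)
  have "1 + z / (1 - z) = inverse (1 - z)"
    using z q by (simp add: field_simps)
  then have "- ln (1 - z) = ln (1 + z / (1 - z))"
    by (simp add: ln_inverse)
  also have "\<dots> \<le> z / (1 - z)"
    using z q by (intro ln_add_one_self_le_self) auto
  also have "\<dots> \<le> z / (1 - q)"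
    using z q by (intro divide_left_mono) auto
  also have "\<dots> = q powr y / (1 - q) * q ^ i"
    using q by (simp add: z_def powr_add powr_realpow)
  finally have "- ln (1 - z) \<le> q powr y / (1 - q) * q ^ i" .
  moreover have "ln (1 - z) \<le> 0"
    using z q by simp
  ultimately show "norm (- ln (1 - q powr (y + real i))) \<le> q powr y / (1 - q) * q ^ i"
    by (simp add: z_def)
qed

text \<open>For \<open>y > 0\<close> every factor is positive, hence the exponential of its
  logarithm, and summability of the logarithms turns the product into one exponential.\<close>

lemma qpochhammer_inf_powr_eq_exp:
  fixes q y :: real
  assumes q: "0 < q" "q < 1" and y: "0 < y"
  shows "qpochhammer_inf (q powr y) q = exp (- (\<Sum>i. - ln (1 - q powr (y + real i))))"
proof -
  have summ: "summable (\<lambda>i. ln (1 - q powr (y + real i)))"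
    using summable_ln_one_minus_powr[of q y] q y by (simp add: summable_minus_iff)
  have "1 - q powr y * q ^ i = exp (ln (1 - q powr (y + real i)))" for i
  proof -
    have "q powr (y + real i) < 1"
      using q y by (simp add: powr01_less_one)
    then show ?thesis
      using q by (simp add: powr_add powr_realpow)
  qed
  then have "qpochhammer_inf (q powr y) q = (\<Prod>i. exp (ln (1 - q powr (y + real i))))"
    by (simp only: qpochhammer_inf_def)
  also have "\<dots> = exp (\<Sum>i. ln (1 - q powr (y + real i)))"
    using summ by (rule prodinf_exp)
  finally show ?thesis
    using summ by (simp add: suminf_minus)
qed

lemma has_integral_suminf_ln_one_minus_powr:
  fixes q t :: real
  assumes q: "0 < q" "q < 1" and t: "0 \<le> t"
  shows "((\<lambda>x. \<Sum>i. - ln (1 - q powr (x + t + real i))) has_integral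
           - (1 / ln q * dilog (q powr t))) {0..1}"
proof (rule has_integral_monotone_convergence_increasing)
  let ?F = "\<lambda>k. dilog (q powr (t + real k)) / ln q"
  fix k
  have "((\<lambda>x. - ln (1 - q powr (x + t + real i))) has_integral (?F (Suc i) - ?F i)) {0..1}" for i
  proof -
    have "((\<lambda>y. - ln (1 - q powr y)) has_integral (?F (Suc i) - ?F i))
            (cbox (t + real i) (t + real i + 1))"
      using has_integral_ln_one_minus_powr[of q "t + real i" "t + real i + 1"] q t
      by (simp add: diff_divide_distrib add_ac)
    \<comment> \<open>The translation \<open>y = x + (t + i)\<close> carries \<open>{0..1}\<close>
      onto the interval of \<open>y\<close>.\<close>
    from has_integral_affinity[OF this, of 1 "t + real i"] show ?thesis
      by (simp add: add_ac)
  qed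
  then have "((\<lambda>x. \<Sum>i<k. - ln (1 - q powr (x + t + real i))) has_integral
               (\<Sum>i<k. ?F (Suc i) - ?F i)) {0..1}"
    by (intro has_integral_sum) auto
  then show "((\<lambda>x. \<Sum>i<k. - ln (1 - q powr (x + t + real i))) has_integral
               (?F k - ?F 0)) {0..1}"
    by (simp only: sum_lessThan_telescope[of ?F])
next
  fix k and x :: real
  assume "x \<in> {0..1}"
  then have "0 < q powr (x + t + real k)" "q powr (x + t + real k) \<le> 1"
    using q t by (auto intro: powr_le1)
  \<comment> \<open>For \<open>x + t + k = 0\<close> this relies on the convention \<open>ln 0 = 0\<close>.\<close>
  moreover have "ln (1 - z) \<le> 0" if "0 < z" "z \<le> 1" for z :: real
    using that by (cases "z = 1") auto
  ultimately have "ln (1 - q powr (x + t + real k)) \<le> 0"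
    by blast
  then show "(\<Sum>i<k. - ln (1 - q powr (x + t + real i))) \<le> (\<Sum>i<Suc k. - ln (1 - q powr (x + t + real i)))"
    by simp
next
  fix x :: real
  assume "x \<in> {0..1}"
  then show "(\<lambda>k. \<Sum>i<k. - ln (1 - q powr (x + t + real i)))
               \<longlonglongrightarrow> (\<Sum>i. - ln (1 - q powr (x + t + real i)))"
    using q t by (intro summable_LIMSEQ summable_ln_one_minus_powr) auto
next
  \<comment> \<open>The upper end of the telescoping sum vanishes: its argument tends to 0 and
    \<open>dilog 0 = 0\<close>.\<close>
  have "(\<lambda>k. q powr t * q ^ k) \<longlonglongrightarrow> q powr t * 0"
    using q by (intro tendsto_intros LIMSEQ_realpow_zero) auto
  then have "(\<lambda>k. q powr (t + real k)) \<longlonglongrightarrow> 0"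
    using q by (simp add: powr_add powr_realpow)
  then have "(\<lambda>k. dilog (q powr (t + real k))) \<longlonglongrightarrow> dilog (0::real)"
    using q t
    by (intro continuous_on_tendsto_compose[OF continuous_on_dilog])
       (auto intro!: always_eventually powr_le1)
  moreover have "dilog (0::real) = 0"
    by (simp add: dilog_def)
  ultimately have "(\<lambda>k. dilog (q powr (t + real k)) / ln q - dilog (q powr (t + real 0)) / ln q)
      \<longlonglongrightarrow> 0 / ln q - dilog (q powr (t + real 0)) / ln q"
    using q by (intro tendsto_intros) auto
  then show "(\<lambda>k. dilog (q powr (t + real k)) / ln q - dilog (q powr (t + real 0)) / ln q)
      \<longlonglongrightarrow> - (1 / ln q * dilog (q powr t))"
    by simp
qed

lemma ln_q_Gamma:
  fixes q y :: real
  assumes q: "0 < q" "q < 1" and y: "0 < y"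
  shows "ln (q_Gamma q y) = ln (qpochhammer_inf q q) +
           (\<Sum>i. - ln (1 - q powr (y + real i))) + (1 - y) * ln (1 - q)"
proof -
  \<comment> \<open>At \<open>y = 1\<close> the product is an exponential; this positivity lets the
    logarithm split.\<close>
  have "qpochhammer_inf q q > 0"
    using qpochhammer_inf_powr_eq_exp[of q 1] q by simp
  then show ?thesis
    using q by (simp add: q_Gamma_def qpochhammer_inf_powr_eq_exp[OF q y] ln_mult ln_div)
qed

lemma has_integral_ln_q_Gamma:
  fixes q t :: real
  assumes q: "0 < q" "q < 1" and t: "0 \<le> t"
  shows "((\<lambda>x. ln (q_Gamma q (x + t))) has_integral
           ((1/2 - t) * ln (1 - q) - 1 / ln q * dilog (q powr t) + ln (qpochhammer_inf q q))) {0..1}"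
\<comment> \<open>The point \<open>x = 0\<close> is removed because for \<open>t = 0\<close> it lies
  outside the range \<open>y > 0\<close> of \<open>ln_q_Gamma\<close>.\<close>
proof (rule has_integral_spike_finite)
  show "finite {0::real}"
    by simp
  show "ln (q_Gamma q (x + t)) = ln (qpochhammer_inf q q) +
          (\<Sum>i. - ln (1 - q powr (x + t + real i))) + (1 - (x + t)) * ln (1 - q)"
    if "x \<in> {0..1} - {0}" for x
    using that q t by (intro ln_q_Gamma) auto
  \<comment> \<open>An antiderivative of the linear term.\<close>
  let ?G = "\<lambda>x. (x - (x + t)\<^sup>2 / 2) * ln (1 - q)"
  have "((\<lambda>x. (1 - (x + t)) * ln (1 - q)) has_integral (?G 1 - ?G 0)) {0..1}"
    by (rule fundamental_theorem_of_calculus)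
       (auto intro!: derivative_eq_intros
             simp: has_real_derivative_iff_has_vector_derivative[symmetric] field_simps)
  moreover have "?G 1 - ?G 0 = (1/2 - t) * ln (1 - q)"
    by (simp add: field_simps power2_eq_square)
  ultimately have lin: "((\<lambda>x. (1 - (x + t)) * ln (1 - q)) has_integral
                          (1/2 - t) * ln (1 - q)) {0..1}"
    by simp
  have const: "((\<lambda>x::real. ln (qpochhammer_inf q q)) has_integral ln (qpochhammer_inf q q)) {0..1}"
    using has_integral_const_real[of "ln (qpochhammer_inf q q)" 0 1] by simp
  show "((\<lambda>x. ln (qpochhammer_inf q q) + (\<Sum>i. - ln (1 - q powr (x + t + real i)))
            + (1 - (x + t)) * ln (1 - q)) has_integral
          ((1/2 - t) * ln (1 - q) - 1 / ln q * dilog (q powr t) + ln (qpochhammer_inf q q))) {0..1}"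
    using has_integral_add[OF has_integral_add
        [OF const has_integral_suminf_ln_one_minus_powr[OF q t]] lin]
    by (simp add: algebra_simps)
qed

lemma dilog_1_eq_zeta_real_2: "dilog (1::real) = zeta_real 2"
  by (simp add: dilog_def zeta_real_def)

theorem theorem2:
  fixes q :: real
  assumes "0 < q" and "q < 1"
  shows "(\<forall>t\<ge>0. ((\<lambda>x. ln (q_Gamma q (x + t))) has_integral
            ((1/2 - t) * ln (1 - q) - 1 / ln q * dilog (q powr t) + ln (qpochhammer_inf q q))) {0..1})
       \<and> ((\<lambda>x. ln (q_Gamma q x)) has_integral
            (1/2 * ln (1 - q) - zeta_real 2 / ln q + ln (qpochhammer_inf q q))) {0..1}"
  using has_integral_ln_q_Gamma[OF assms] has_integral_ln_q_Gamma[OF assms, of 0] assms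
  by (simp add: dilog_1_eq_zeta_real_2)

end
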